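(* For $u,v,n \in \mathbb{N}$, let $D(u,v,n)$ denote the number of admissible coloured partitions (as defined in the context) whose size is $n$ and whose weights are $u$ and $v$. Then, as formal power series in $a,b,q$, \begin{equation*} \sum_{u,v,n \in \mathbb{N}} D(u,v,n)\,a^u b^v q^n = \prod_{n\geq 1} \left(1+aq^n\right)\left(1+bq^n\right). \end{equation*}
   Context: Coloured integers: every positive integer $k$ occurs in the three colours $a$, $b$, $ab$ (written $k_a$, $k_b$, $k_{ab}$). In addition, odd positive integers occur in the colours $a^2$ and $b^2$: $k_{b^2}$ for every odd $k\ge 1$ and $k_{a^2}$ for every odd $k \geq 3$. The integer value of $k_x$ is $k$ and its colour is $x$. These coloured integers are totally ordered by $$1_{ab} < 1_a < 1_{b^2} <1_{b} <2_{ab} < 2_a <3_{a^2} < 2_{b} <3_{ab} < 3_a < 3_{b^2} <3_b <4_{ab}<4_a<5_{a^2}<4_b<5_{ab}<\cdots,$$ that is, for every odd $m\ge1$: $m_{ab}<m_a<m_{b^2}<m_b<(m+1)_{ab}<(m+1)_a<(m+2)_{a^2}<(m+1)_b<(m+2)_{ab}$. Difference conditions: for a coloured integer $\lambda$ (the "upper" part) of colour $x$ and a coloured integer $\mu$ (the "lower" part) of colour $y$, a minimal difference $A(\lambda,\mu)$ is defined as follows, where the row is determined by the colour and the parity of the integer value of $\lambda$, and the entries are listed for $y = a, b, ab, a^2, b^2$ in this order: - $\lambda$ of colour $a$, odd: $2,2,1,2,2$; - $\lambda$ of colour $b^2$: $2,3,2,2,4$; - $\lambda$ of colour $b$, odd: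 $1,2,1,2,2$; - $\lambda$ of colour $ab$, even: $2,2,2,3,3$; - $\lambda$ of colour $a$, even: $2,2,2,3,3$; - $\lambda$ of colour $a^2$: $3,3,3,4,4$; - $\lambda$ of colour $b$, even: $1,2,1,1,3$; - $\lambda$ of colour $ab$, odd: $2,3,2,2,3$. An admissible coloured partition is a finite (possibly empty) sequence $\lambda_1,\dots,\lambda_s$ of coloured integers, none of which equals $1_{ab}$ or $1_{b^2}$, such that for every $1\le i<s$ the integer values satisfy $\lambda_i-\lambda_{i+1}\ge A(\lambda_i,\lambda_{i+1})$. Its size is the sum of the integer values of its parts. Its weight $u$ is the number of parts of colour $a$ or $ab$ plus twice the number of parts of colour $a^2$; its weight $v$ is the number of parts of colour $b$ or $ab$ plus twice the number of parts of colour $b^2$. *)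

theory Defs
  imports "HOL-Computational_Algebra.Polynomial"
begin

datatype colour = Ca | Cb | Cab | Ca2 | Cb2

type_synonym cint = "nat \<times> colour"

definition valid_cint :: "cint \<Rightarrow> bool" where
  "valid_cint x = (case x of (k, c) \<Rightarrow> k \<ge> 1 \<and>
     (c = Ca2 \<longrightarrow> odd k \<and> k \<ge> 3) \<and> (c = Cb2 \<longrightarrow> odd k))"

text \<open>Position in the total order
  1_ab < 1_a < 1_b2 < 1_b < 2_ab < 2_a < 3_a2 < 2_b < 3_ab < ...\<close>
fun rank :: "cint \<Rightarrow> nat" where
  "rank (k, c) =
     (if odd k then
        (case c of Cab \<Rightarrow> 8 * ((k - 1) div 2)
                 | Ca \<Rightarrow> 8 * ((k - 1) div 2) + 1
                 | Cb2 \<Rightarrow> 8 * ((k - 1) div 2) + 2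
                 | Cb \<Rightarrow> 8 * ((k - 1) div 2) + 3
                 | Ca2 \<Rightarrow> 8 * ((k - 1) div 2) - 2)
      else
        (case c of Cab \<Rightarrow> 8 * ((k - 2) div 2) + 4
                 | Ca \<Rightarrow> 8 * ((k - 2) div 2) + 5
                 | Cb \<Rightarrow> 8 * ((k - 2) div 2) + 7
                 | _ \<Rightarrow> 0))"

definition cless :: "cint \<Rightarrow> cint \<Rightarrow> bool" where
  "cless x y = (rank x < rank y)"

definition row :: "nat \<times> nat \<times> nat \<times> nat \<times> nat \<Rightarrow> colour \<Rightarrow> nat" where
  "row r y = (case r of (ea, eb, eab, ea2, eb2) \<Rightarrow>
     (case y of Ca \<Rightarrow> ea | Cb \<Rightarrow> eb | Cab \<Rightarrow> eab | Ca2 \<Rightarrow> ea2 | Cb2 \<Rightarrow> eb2))"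

fun mindiff :: "cint \<Rightarrow> cint \<Rightarrow> nat" where
  "mindiff (k, x) (l, y) = row
     (case x of
        Ca \<Rightarrow> if odd k then (2,2,1,2,2) else (2,2,2,3,3)
      | Cb2 \<Rightarrow> (2,3,2,2,4)
      | Cb \<Rightarrow> if odd k then (1,2,1,2,2) else (1,2,1,1,3)
      | Cab \<Rightarrow> if even k then (2,2,2,3,3) else (2,3,2,2,3)
      | Ca2 \<Rightarrow> (3,3,3,4,4)) y"

definition admissible :: "cint list \<Rightarrow> bool" where
  "admissible p = ((\<forall>x \<in> set p. valid_cint x \<and> x \<noteq> (1, Cab) \<and> x \<noteq> (1, Cb2)) \<and>
     sorted_wrt (\<lambda>x y. cless y x) p \<and>
     (\<forall>i. Suc i < length p \<longrightarrow>
        int (fst (p ! i)) - int (fst (p ! Suc i)) \<ge> int (mindiff (p ! i) (p ! Suc i))))"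

definition psize :: "cint list \<Rightarrow> nat" where
  "psize p = (\<Sum>x \<leftarrow> p. fst x)"

definition weight_u :: "cint list \<Rightarrow> nat" where
  "weight_u p = length (filter (\<lambda>x. snd x = Ca \<or> snd x = Cab) p)
              + 2 * length (filter (\<lambda>x. snd x = Ca2) p)"

definition weight_v :: "cint list \<Rightarrow> nat" where
  "weight_v p = length (filter (\<lambda>x. snd x = Cb \<or> snd x = Cab) p)
              + 2 * length (filter (\<lambda>x. snd x = Cb2) p)"

definition D :: "nat \<Rightarrow> nat \<Rightarrow> nat \<Rightarrow> nat" where
  "D u v n = card {p. admissible p \<and> psize p = n \<and> weight_u p = u \<and> weight_v p = v}"

text \<open>Polynomials in three variables as nested univariate polynomials:
  outer variable q, middle variable b, inner variable a.\<close>
definition var_q :: "int poly poly poly" where "var_q = [:0, 1:]"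
definition var_b :: "int poly poly poly" where "var_b = [:[:0, 1:]:]"
definition var_a :: "int poly poly poly" where "var_a = [:[:[:0, 1:]:]:]"

definition coeff3 :: "int poly poly poly \<Rightarrow> nat \<Rightarrow> nat \<Rightarrow> nat \<Rightarrow> int" where
  "coeff3 P u v n = coeff (coeff (coeff P n) v) u"

definition partial_prod :: "nat \<Rightarrow> int poly poly poly" where
  "partial_prod N = (\<Prod>k\<in>{1..N}. (1 + var_a * var_q ^ k) * (1 + var_b * var_q ^ k))"

end

theory Submission
  imports Defs
begin

text \<open>
  Let \<open>G a b r\<close> be the generating function of the admissible partitions whose largest part has rank
  at most \<open>r\<close>, and \<open>S a b j\<close> that of the partitions which may follow a part \<open>(2 * j + 2, Ca)\<close>.
  Removing the largest part gives linear recurrences with period 8 in the rank.  They imply, by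
  a simultaneous induction on \<open>j\<close>, the finite functional equations
  \<open>G a b (8 * j + 4) = (1 + a * q) * G b (a * q) (8 * j + 1)\<close> and
  \<open>G a b (8 * j + 1) = (1 + a * q) * S b (a * q) j\<close>.  Both \<open>S a b j\<close> and \<open>G a b (8 * j + 4)\<close> agree
  with the full generating function up to \<open>q ^ (2 * j)\<close>, so in the limit this function picks up the
  factor \<open>(1 + a * q) * (1 + b * q)\<close> when \<open>(a, b)\<close> is replaced by \<open>(a * q, b * q)\<close>.  Iterating
  this produces the product.
\<close>

section \<open>Admissible partitions by their largest part\<close>

definition parts :: "cint set" where
  "parts = {x. valid_cint x \<and> x \<noteq> (1, Cab) \<and> x \<noteq> (1, Cb2)}"

definition below :: "cint \<Rightarrow> cint set" where
  "below x = {y \<in> parts. cless y x \<and> fst y + mindiff x y \<le> fst x}"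

definition upto_rank :: "nat \<Rightarrow> cint set" where
  "upto_rank r = {y \<in> parts. rank y \<le> r}"

definition adm :: "cint set \<Rightarrow> cint list set" where
  "adm Q = {p. admissible p \<and> (p \<noteq> [] \<longrightarrow> hd p \<in> Q)}"

lemma finite_colour: "finite (UNIV :: colour set)"
proof -
  have "UNIV = {Ca, Cb, Cab, Ca2, Cb2}"
    using colour.exhaust by blast
  moreover have "finite {Ca, Cb, Cab, Ca2, Cb2}" by simp
  ultimately show ?thesis by metis
qed

lemma admissible_Nil: "admissible []"
  by (simp add: admissible_def)

text \<open>Sortedness concerns all pairs, but by transitivity of \<open>cless\<close> comparing
  \<open>x\<close> with the head of \<open>p\<close> suffices.\<close>

lemma admissible_Cons:
  "admissible (x # p) \<longleftrightarrow> x \<in> parts \<and> admissible p \<and> (p \<noteq> [] \<longrightarrow> hd p \<in> below x)"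
proof (cases p)
  case Nil
  then show ?thesis by (simp add: admissible_def parts_def)
next
  case (Cons y ps)
  have diff: "(\<forall>i. Suc i < length (x # p) \<longrightarrow>
        int (fst ((x # p) ! i)) - int (fst ((x # p) ! Suc i)) \<ge> int (mindiff ((x # p) ! i) ((x # p) ! Suc i)))
     \<longleftrightarrow> fst y + mindiff x y \<le> fst x \<and> (\<forall>i. Suc i < length p \<longrightarrow>
        int (fst (p ! i)) - int (fst (p ! Suc i)) \<ge> int (mindiff (p ! i) (p ! Suc i)))" (is "(\<forall>i. ?L i) \<longleftrightarrow> ?R")
  proof -
    have "(\<forall>i. ?L i) \<longleftrightarrow> ?L 0 \<and> (\<forall>i. ?L (Suc i))"
      by (metis not0_implies_Suc)
    also have "?L 0 \<longleftrightarrow> fst y + mindiff x y \<le> fst x"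
      using Cons by (simp del: mindiff.simps) linarith
    finally show ?thesis by simp
  qed
  have srt: "sorted_wrt (\<lambda>x y. cless y x) (x # p) \<longleftrightarrow> cless y x \<and> sorted_wrt (\<lambda>x y. cless y x) p"
    using Cons by (auto simp: cless_def)
  show ?thesis
    unfolding admissible_def diff srt using Cons
    by (auto simp: parts_def below_def)
qed

lemma mindiff_pos: "mindiff x y \<ge> 1"
  by (cases x; cases y) (auto simp: row_def split: colour.splits)

lemma below_fst_less: "y \<in> below x \<Longrightarrow> fst y < fst x"
  using mindiff_pos[of x y] by (auto simp: below_def)

lemma finite_fst_less: "finite {y :: cint. fst y < n}"
proof -
  have "{y :: cint. fst y < n} = {..<n} \<times> UNIV" by auto
  then show ?thesis by (simp add: finite_colour)
qed

lemma finite_below: "finite (below x)"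
  by (rule finite_subset[OF _ finite_fst_less[of "fst x"]]) (auto dest: below_fst_less)

lemma adm_eq: "adm Q = insert [] (\<Union>x \<in> Q \<inter> parts. (#) x ` adm (below x))"
proof (rule set_eqI)
  fix p show "p \<in> adm Q \<longleftrightarrow> p \<in> insert [] (\<Union>x \<in> Q \<inter> parts. (#) x ` adm (below x))"
    by (cases p) (auto simp: adm_def admissible_Nil admissible_Cons)
qed

text \<open>Integer values strictly decrease along a partition, which allows induction on a bound
  for the head.\<close>

lemma finite_adm_fst_less: "finite (adm {y. fst y < n})"
proof (induction n)
  case 0
  then show ?case by (subst adm_eq) simp
next
  case (Suc n)
  have "finite (adm (below x))" if "fst x < Suc n" for x
    by (rule finite_subset[OF _ Suc.IH]) (use that below_fst_less in \<open>fastforce simp: adm_def\<close>)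
  then show ?case
    using finite_fst_less[of "Suc n"] by (subst adm_eq) auto
qed

lemma finite_adm:
  assumes "finite Q" shows "finite (adm Q)"
proof -
  have "finite (adm (below x))" for x
    by (rule finite_subset[OF _ finite_adm_fst_less[of "fst x"]])
      (use below_fst_less in \<open>fastforce simp: adm_def\<close>)
  then show ?thesis
    using assms by (subst adm_eq) auto
qed

section \<open>Generating functions\<close>

fun part_weight :: "'r::comm_ring_1 \<Rightarrow> 'r \<Rightarrow> 'r \<Rightarrow> cint \<Rightarrow> 'r" where
  "part_weight a b q (k, c) =
     (case c of Ca \<Rightarrow> a | Cb \<Rightarrow> b | Cab \<Rightarrow> a * b | Ca2 \<Rightarrow> a\<^sup>2 | Cb2 \<Rightarrow> b\<^sup>2) * q ^ k"

text \<open>With \<open>a\<close>, \<open>b\<close>, \<open>q\<close> in an arbitrary commutative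
  ring, a substitution such as \<open>(b, a * q)\<close> for \<open>(a, b)\<close> is a change of
  arguments. For finite \<open>Q\<close> the sum is finite, so no power series occur.\<close>

definition genfun :: "'r::comm_ring_1 \<Rightarrow> 'r \<Rightarrow> 'r \<Rightarrow> cint set \<Rightarrow> 'r" where
  "genfun a b q Q = (\<Sum>p\<in>adm Q. prod_list (map (part_weight a b q) p))"

lemma genfun_empty: "genfun a b q {} = 1"
proof -
  have "adm {} = {[]}" by (subst adm_eq) simp
  then show ?thesis by (simp add: genfun_def)
qed

lemma genfun_insert:
  assumes "finite Q" "x \<in> parts" "x \<notin> Q"
  shows "genfun a b q (insert x Q) = genfun a b q Q + part_weight a b q x * genfun a b q (below x)"
proof -
  have eq: "adm (insert x Q) = adm Q \<union> (#) x ` adm (below x)"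
    using assms(2) by (subst (1 2) adm_eq) auto
  have disj: "adm Q \<inter> (#) x ` adm (below x) = {}"
    using assms(3) by (auto simp: adm_def)
  have "genfun a b q (insert x Q)
      = genfun a b q Q + (\<Sum>p\<in>(#) x ` adm (below x). prod_list (map (part_weight a b q) p))"
    unfolding genfun_def eq
    by (rule sum.union_disjoint) (use disj assms(1) in \<open>auto intro: finite_adm finite_below\<close>)
  also have "(\<Sum>p\<in>(#) x ` adm (below x). prod_list (map (part_weight a b q) p))
      = part_weight a b q x * genfun a b q (below x)"
    by (subst sum.reindex) (auto simp: genfun_def sum_distrib_left)
  finally show ?thesis .
qed

section \<open>Successor sets and initial segments of the order\<close>

lemma finite_upto_rank: "finite (upto_rank r)"
proof (rule finite_subset[OF _ finite_fst_less[of "r + 4"]])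
  have "fst y < r + 4" if "y \<in> parts" "rank y \<le> r" for y
  proof (cases y)
    case (Pair k c)
    with that show ?thesis
      by (cases c) (auto simp: parts_def valid_cint_def split: if_splits elim!: oddE evenE)
  qed
  then show "upto_rank r \<subseteq> {y. fst y < r + 4}" by (auto simp: upto_rank_def)
qed

text \<open>One family for each residue of the rank modulo 8, in the order 0 to 7. Ranks become
  linear in \<open>i\<close>, within reach of \<open>presburger\<close>.\<close>

lemma parts_cases:
  assumes "y \<in> parts"
  obtains i where "y = (2 * i + 3, Cab)" | i where "y = (2 * i + 1, Ca)"
    | i where "y = (2 * i + 3, Cb2)" | i where "y = (2 * i + 1, Cb)"
    | i where "y = (2 * i + 2, Cab)" | i where "y = (2 * i + 2, Ca)"
    | i where "y = (2 * i + 3, Ca2)" | i where "y = (2 * i + 2, Cb)"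
proof -
  obtain k c where y: "y = (k, c)" by (cases y)
  show thesis
  proof (cases "even k")
    case True
    moreover have "k \<ge> 1" using assms by (simp add: y parts_def valid_cint_def)
    ultimately have "\<exists>i. k = 2 * i + 2" by presburger
    then obtain i where "k = 2 * i + 2" ..
    then show ?thesis
      using assms that unfolding y parts_def valid_cint_def by (cases c) auto
  next
    case False
    then obtain i where i: "k = 2 * i + 1" by (auto elim!: oddE)
    show ?thesis
    proof (cases i)
      case 0
      then show ?thesis
        using assms i that(2,4)[of 0] unfolding y parts_def valid_cint_def by (cases c) auto
    next
      case (Suc l)
      then have "k = 2 * l + 3" "k = 2 * Suc l + 1" using i by auto
      then show ?thesis
        using assms that(1,3,7)[of l] that(2,4)[of "Suc l"]
        unfolding y parts_def valid_cint_def by (cases c) auto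
    qed
  qed
qed

lemma part_simps:
  "(2 * i + 3, Cab) \<in> parts" "(2 * i + 1, Ca) \<in> parts" "(2 * i + 3, Cb2) \<in> parts"
  "(2 * i + 1, Cb) \<in> parts" "(2 * i + 2, Cab) \<in> parts" "(2 * i + 2, Ca) \<in> parts"
  "(2 * i + 3, Ca2) \<in> parts" "(2 * i + 2, Cb) \<in> parts"
  "(2 * i + 3, Ca) \<in> parts" "(2 * i + 3, Cb) \<in> parts"
  "rank (2 * i + 3, Cab) = 8 * i + 8" "rank (2 * i + 1, Ca) = 8 * i + 1"
  "rank (2 * i + 3, Cb2) = 8 * i + 10" "rank (2 * i + 1, Cb) = 8 * i + 3"
  "rank (2 * i + 2, Cab) = 8 * i + 4" "rank (2 * i + 2, Ca) = 8 * i + 5"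
  "rank (2 * i + 3, Ca2) = 8 * i + 6" "rank (2 * i + 2, Cb) = 8 * i + 7"
  "rank (2 * i + 3, Ca) = 8 * i + 9" "rank (2 * i + 3, Cb) = 8 * i + 11"
  "rank (2 * i + 4, Ca) = 8 * i + 13" "(1, Ca) \<in> parts" "(1, Cb) \<in> parts"
  "rank (1, Ca) = 1" "rank (1, Cb) = 3" "rank (2, Ca) = 5"
  by (auto simp: parts_def valid_cint_def)

lemma subset_parts: "below x \<subseteq> parts" "upto_rank r \<subseteq> parts"
  by (auto simp: below_def upto_rank_def)

lemma set_eq_parts:
  assumes "A \<subseteq> parts" "B \<subseteq> parts" "\<And>y. y \<in> parts \<Longrightarrow> y \<in> A \<longleftrightarrow> y \<in> B"
  shows "A = B"
  using assms by blast

text \<open>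
  For a part of rank \<open>4\<close>, \<open>5\<close> or \<open>6\<close> modulo \<open>8\<close> the set of possible successors is not an initial
  segment of the order: unless it is empty, its largest element is some \<open>(k, Cb)\<close> with \<open>k\<close> even, but
  it omits the smaller \<open>(k + 1, Ca2)\<close>.
\<close>

lemma below_eq:
  "below (1, Ca) = {}" "below (1, Cb) = {}" "below (2, Ca) = {}"
  "below (2 * j + 3, Cab) = upto_rank (8 * j + 1)"
  "below (2 * j + 3, Ca) = upto_rank (8 * j + 4)"
  "below (2 * j + 3, Cb2) = upto_rank (8 * j + 1)"
  "below (2 * j + 3, Cb) = upto_rank (8 * j + 5)"
  "below (2 * j + 2, Cb) = upto_rank (8 * j + 1)"
  "below (2 * j + 2, Cab) = below (2 * j + 2, Ca)"
  "below (2 * j + 3, Ca2) = below (2 * j + 2, Ca)"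
  "below (2 * j + 4, Ca) = insert (2 * j + 2, Cb) (upto_rank (8 * j + 5))"
  apply (rule_tac[!] set_eq_parts)
  apply (simp_all only: subset_parts part_simps insert_subset empty_subsetI simp_thms)
  apply (erule_tac[!] parts_cases)
  apply (simp_all only: below_def upto_rank_def part_simps cless_def mem_Collect_eq insert_iff empty_iff)
  apply (simp_all add: row_def del: rank.simps)
  apply presburger+
  done

text \<open>Every positive rank except 2 belongs to exactly one part; the excluded
  \<open>(1, Cab)\<close> and \<open>(1, Cb2)\<close> leave ranks 0 and 2 empty.\<close>

lemma upto_rank_eq:
  "upto_rank 1 = {(1, Ca)}"
  "upto_rank 3 = insert (1, Cb) (upto_rank 1)"
  "upto_rank (8 * j + 4) = insert (2 * j + 2, Cab) (upto_rank (8 * j + 3))"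
  "upto_rank (8 * j + 5) = insert (2 * j + 2, Ca) (upto_rank (8 * j + 4))"
  "upto_rank (8 * j + 6) = insert (2 * j + 3, Ca2) (upto_rank (8 * j + 5))"
  "upto_rank (8 * j + 7) = insert (2 * j + 2, Cb) (upto_rank (8 * j + 6))"
  "upto_rank (8 * j + 8) = insert (2 * j + 3, Cab) (upto_rank (8 * j + 7))"
  "upto_rank (8 * j + 9) = insert (2 * j + 3, Ca) (upto_rank (8 * j + 8))"
  "upto_rank (8 * j + 10) = insert (2 * j + 3, Cb2) (upto_rank (8 * j + 9))"
  "upto_rank (8 * j + 11) = insert (2 * j + 3, Cb) (upto_rank (8 * j + 10))"
  apply (rule_tac[!] set_eq_parts)
  apply (simp_all only: subset_parts part_simps insert_subset empty_subsetI simp_thms)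
  apply (erule_tac[!] parts_cases)
  apply (simp_all only: below_def upto_rank_def part_simps cless_def mem_Collect_eq insert_iff empty_iff)
  apply (simp_all add: row_def del: rank.simps)
  apply presburger+
  done

section \<open>Recurrences and functional equations\<close>

context
  fixes q :: "'r::comm_ring_1"
begin

abbreviation G :: "'r \<Rightarrow> 'r \<Rightarrow> nat \<Rightarrow> 'r" where
  "G a b r \<equiv> genfun a b q (upto_rank r)"

abbreviation S :: "'r \<Rightarrow> 'r \<Rightarrow> nat \<Rightarrow> 'r" where
  "S a b j \<equiv> genfun a b q (below (2 * j + 2, Ca))"

lemma genfun_upto_rank_insert:
  assumes "upto_rank r' = insert x (upto_rank r)" "x \<in> parts" "rank x > r"
  shows "G a b r' = G a b r + part_weight a b q x * genfun a b q (below x)"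
  unfolding assms(1) by (rule genfun_insert)
    (use assms finite_upto_rank in \<open>auto simp: upto_rank_def\<close>)

lemma G_initial:
  "G a b 1 = 1 + a * q"
  "G a b 3 = G a b 1 + b * q"
  "S a b 0 = 1"
proof -
  show "G a b 1 = 1 + a * q"
    unfolding upto_rank_eq by (subst genfun_insert)
      (auto simp: part_simps below_eq genfun_empty simp del: One_nat_def)
  show "G a b 3 = G a b 1 + b * q"
    by (subst genfun_upto_rank_insert[OF upto_rank_eq(2)])
      (auto simp: part_simps below_eq genfun_empty simp del: One_nat_def rank.simps)
  show "S a b 0 = 1"
    by (simp only: mult_0_right add_0 below_eq(3) genfun_empty)
qed

text \<open>Each step admits the part of the next rank as head. By \<open>below_eq\<close> the parts
  of rank 4, 5 and 6 modulo 8 share the successor set behind \<open>S\<close>.\<close>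

lemma G_step:
  "G a b (8 * j + 4) = G a b (8 * j + 3) + a * b * q ^ (2 * j + 2) * S a b j"
  "G a b (8 * j + 5) = G a b (8 * j + 4) + a * q ^ (2 * j + 2) * S a b j"
  "G a b (8 * j + 6) = G a b (8 * j + 5) + a\<^sup>2 * q ^ (2 * j + 3) * S a b j"
  "G a b (8 * j + 7) = G a b (8 * j + 6) + b * q ^ (2 * j + 2) * G a b (8 * j + 1)"
  "G a b (8 * j + 8) = G a b (8 * j + 7) + a * b * q ^ (2 * j + 3) * G a b (8 * j + 1)"
  "G a b (8 * j + 9) = G a b (8 * j + 8) + a * q ^ (2 * j + 3) * G a b (8 * j + 4)"
  "G a b (8 * j + 10) = G a b (8 * j + 9) + b\<^sup>2 * q ^ (2 * j + 3) * G a b (8 * j + 1)"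
  "G a b (8 * j + 11) = G a b (8 * j + 10) + b * q ^ (2 * j + 3) * G a b (8 * j + 5)"
  by (simp_all only: genfun_upto_rank_insert[OF upto_rank_eq(3)] genfun_upto_rank_insert[OF upto_rank_eq(4)]
    genfun_upto_rank_insert[OF upto_rank_eq(5)] genfun_upto_rank_insert[OF upto_rank_eq(6)]
    genfun_upto_rank_insert[OF upto_rank_eq(7)] genfun_upto_rank_insert[OF upto_rank_eq(8)]
    genfun_upto_rank_insert[OF upto_rank_eq(9)] genfun_upto_rank_insert[OF upto_rank_eq(10)]
    part_simps below_eq part_weight.simps colour.case)

lemma S_Suc: "S a b (Suc j) = G a b (8 * j + 5) + b * q ^ (2 * j + 2) * G a b (8 * j + 1)"
proof -
  have "S a b (Suc j) = genfun a b q (insert (2 * j + 2, Cb) (upto_rank (8 * j + 5)))"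
    unfolding below_eq(11)[symmetric]
    by (rule arg_cong[where f = "\<lambda>k. genfun a b q (below (k, Ca))"]) simp
  also have "\<dots> = G a b (8 * j + 5) + part_weight a b q (2 * j + 2, Cb) * genfun a b q (below (2 * j + 2, Cb))"
    by (rule genfun_insert[OF finite_upto_rank])
      (simp_all add: part_simps(8,18) upto_rank_def del: rank.simps add_2_eq_Suc')
  finally show ?thesis by (simp only: below_eq part_weight.simps colour.case)
qed

text \<open>The second equation serves only to make the induction go through.\<close>

lemma functional_equations:
  "G a b (8 * j + 4) = (1 + a * q) * G b (a * q) (8 * j + 1) \<and>
   G b (a * q) (8 * j + 3) = G b (a * q) (8 * j + 1) + a * q ^ (2 * j + 2) * S a b j \<and>
   G a b (8 * j + 1) = (1 + a * q) * S b (a * q) j"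
proof (induction j)
  case 0
  have S0: "genfun a b q (below (2, Ca)) = 1" "genfun b (a * q) q (below (2, Ca)) = 1"
    using G_initial(3) by (simp_all only: mult_0_right add_0)
  have "G a b 4 = G a b 3 + a * b * q ^ 2"
    using G_step(1)[of a b 0] by (simp only: S0 mult_0_right add_0 mult_1_right)
  then have G4: "G a b 4 = (1 + a * q) * (1 + b * q)"
    by (simp only: G_initial ring_distribs mult_1_left mult_1_right power2_eq_square ac_simps)
  show ?case
    unfolding mult_0_right add_0 G4 G_initial S0 by (simp add: power2_eq_square mult_ac)
next
  case (Suc j)
  define z where "z = q ^ (2 * j + 2)"
  have z: "q ^ (2 * j + 2) = z" "q ^ (2 * j + 3) = z * q" "q ^ (2 * Suc j + 2) = z * q\<^sup>2"
    by (simp_all add: z_def power_add power2_eq_square power3_eq_cube)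
  have idx: "8 * Suc j + 3 = 8 * j + 11" "8 * Suc j + 1 = 8 * j + 9"
    by simp_all
  note IH = Suc.IH[unfolded z, THEN conjunct1] Suc.IH[unfolded z, THEN conjunct2, THEN conjunct1]
    Suc.IH[unfolded z, THEN conjunct2, THEN conjunct2]
  \<comment> \<open>These rules leave polynomials in \<open>a\<close>, \<open>b\<close>,
    \<open>q\<close>, \<open>z\<close> and the three unknowns \<open>S a b j\<close>,
    \<open>S b (a * q) j\<close>, \<open>G b (a * q) (8 * j + 1)\<close>. \<open>G_step(1)\<close>
    for \<open>a b j\<close> is left out, since the induction hypothesis already rewrites
    \<open>G a b (8 * j + 4)\<close>.\<close>
  note reduce = IH S_Suc[of a b j, unfolded z] S_Suc[of b "a * q" j, unfolded z]
    G_step(2-8)[of a b j, unfolded z] G_step[of b "a * q" j, unfolded z]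
    G_step(1)[of a b "Suc j", unfolded z idx]
  have D: "G a b (8 * j + 9) = (1 + a * q) * S b (a * q) (Suc j)"
    by (simp only: reduce) (simp add: algebra_simps power2_eq_square)
  have C: "G b (a * q) (8 * j + 11) = G b (a * q) (8 * j + 9) + a * (z * q\<^sup>2) * S a b (Suc j)"
    by (simp only: reduce) (simp add: algebra_simps power2_eq_square)
  have A: "G a b (8 * Suc j + 4) = (1 + a * q) * G b (a * q) (8 * j + 9)"
    by (simp only: reduce) (simp add: algebra_simps power2_eq_square)
  show ?case unfolding idx z using A C D by blast
qed

section \<open>Congruences modulo powers of q\<close>

lemma dvd_G_minus_S: "q ^ (2 * j) dvd G a b (8 * j + 4) - S a b j"
proof (cases j)
  case 0
  then show ?thesis by simp
next
  case (Suc i)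
  define z where "z = q ^ (2 * i + 2)"
  have z: "q ^ (2 * i + 2) = z" "q ^ (2 * i + 3) = z * q" "q ^ (2 * Suc i + 2) = z * q\<^sup>2"
    "q ^ (2 * Suc i) = z"
    by (simp_all add: z_def power_add power2_eq_square power3_eq_cube)
  have idx: "8 * Suc i + 3 = 8 * i + 11" by simp
  \<comment> \<open>One term for each of the six heads, of value \<open>2 * i + 3\<close> or
    \<open>2 * i + 4\<close>, that only \<open>G\<close> admits.\<close>
  have "G a b (8 * Suc i + 4) - S a b (Suc i) = z *
      (a\<^sup>2 * q * S a b i + a * b * q * G a b (8 * i + 1) + a * q * G a b (8 * i + 4)
       + b\<^sup>2 * q * G a b (8 * i + 1) + b * q * G a b (8 * i + 5) + a * b * q\<^sup>2 * S a b (Suc i))"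
    unfolding G_step(1)[of a b "Suc i"] idx G_step(4-8)[of a b i] G_step(3)[of a b i] S_Suc[of a b i] z
    by (simp only: algebra_simps)
  then show ?thesis unfolding Suc z by simp
qed

text \<open>The first functional equation at \<open>(a, b)\<close> and the third at
  \<open>(b, a * q)\<close> compose to the shift to \<open>(a * q, b * q)\<close>.\<close>

lemma dvd_S_shift: "q ^ (2 * j) dvd S a b j - (1 + a * q) * (1 + b * q) * S (a * q) (b * q) j"
proof -
  have eq: "G a b (8 * j + 4) = (1 + a * q) * (1 + b * q) * S (a * q) (b * q) j"
    using functional_equations[of a b j] functional_equations[of b "a * q" j]
    by (simp only: mult.assoc)
  show ?thesis
    unfolding eq[symmetric] using dvd_G_minus_S[of j a b] by (metis dvd_minus_iff minus_diff_eq)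
qed

lemma dvd_S_shift_iterated:
  "q ^ (2 * j) dvd S a b j -
     (\<Prod>k=1..N. (1 + a * q ^ k) * (1 + b * q ^ k)) * S (a * q ^ N) (b * q ^ N) j"
proof (induction N)
  case 0
  then show ?case by simp
next
  case (Suc N)
  define P where "P = (\<Prod>k=1..N. (1 + a * q ^ k) * (1 + b * q ^ k))"
  \<comment> \<open>The next summand of a telescoping sum: the shift at
    \<open>(a * q ^ N, b * q ^ N)\<close>, times the product so far.\<close>
  have "q ^ (2 * j) dvd P * (S (a * q ^ N) (b * q ^ N) j -
      (1 + a * q ^ Suc N) * (1 + b * q ^ Suc N) * S (a * q ^ Suc N) (b * q ^ Suc N) j)"
    using dvd_S_shift[of j "a * q ^ N" "b * q ^ N"] by (simp add: mult_ac dvd_mult)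
  from dvd_add[OF Suc.IH[folded P_def] this] show ?case
    by (simp add: P_def algebra_simps)
qed

end

text \<open>The weight of every part contains a factor \<open>a\<close> or \<open>b\<close>, so only
  the empty partition survives modulo \<open>d\<close>. With \<open>d = q ^ N\<close> this removes
  the factor left over after \<open>N\<close> shifts.\<close>

lemma dvd_genfun_minus_1:
  assumes "finite Q" "d dvd a" "d dvd b"
  shows "d dvd genfun a b q Q - 1"
proof -
  have weight: "d dvd part_weight a b q x" for x
    using assms(2,3) by (cases x) (auto split: colour.split simp: power2_eq_square)
  have "genfun a b q Q - 1 = (\<Sum>p\<in>adm Q - {[]}. prod_list (map (part_weight a b q) p))"
    unfolding genfun_def
    by (subst sum.remove[OF finite_adm[OF assms(1)], of "[]"]) (auto simp: adm_def admissible_Nil)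
  also have "d dvd \<dots>"
  proof (rule dvd_sum)
    fix p assume "p \<in> adm Q - {[]}"
    then obtain x p' where "p = x # p'" by (cases p) auto
    then show "d dvd prod_list (map (part_weight a b q) p)" using weight[of x] by simp
  qed
  finally show ?thesis .
qed

section \<open>Coefficients in three variables\<close>

lemma prod_list_part_weight:
  "prod_list (map (part_weight a b q) p) = a ^ weight_u p * b ^ weight_v p * q ^ psize p"
proof (induction p)
  case Nil
  then show ?case by (simp add: weight_u_def weight_v_def psize_def)
next
  case (Cons x p)
  obtain k c where x: "x = (k, c)" by (cases x)
  show ?case
    by (cases c) (simp_all add: Cons x weight_u_def weight_v_def psize_def power_add power2_eq_square mult_ac)
qed

lemma var_monom:
  "var_a = monom (monom (monom 1 1) 0) 0" "var_b = monom (monom 1 1) 0" "var_q = monom 1 1"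
  by (simp_all add: var_a_def var_b_def var_q_def monom_0 monom_Suc)

lemma coeff3_monomial:
  "coeff3 (var_a ^ u' * var_b ^ v' * var_q ^ n') u v n = (if u' = u \<and> v' = v \<and> n' = n then 1 else 0)"
  unfolding var_monom coeff3_def by (simp add: monom_power mult_monom)

lemma coeff3_sum: "coeff3 (sum f A) u v n = (\<Sum>x\<in>A. coeff3 (f x) u v n)"
  by (simp add: coeff3_def coeff_sum)

lemma coeff3_genfun:
  assumes "finite Q"
  shows "coeff3 (genfun var_a var_b var_q Q) u v n =
    int (card {p \<in> adm Q. psize p = n \<and> weight_u p = u \<and> weight_v p = v})"
proof -
  have "coeff3 (genfun var_a var_b var_q Q) u v n =
      (\<Sum>p\<in>adm Q. if psize p = n \<and> weight_u p = u \<and> weight_v p = v then 1 else 0)"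
    unfolding genfun_def prod_list_part_weight coeff3_sum coeff3_monomial
    by (rule sum.cong) auto
  also have "\<dots> = int (card {p \<in> adm Q. psize p = n \<and> weight_u p = u \<and> weight_v p = v})"
    using finite_adm[OF assms] by (subst sum.inter_filter[symmetric]) auto
  finally show ?thesis .
qed

lemma coeff3_eq_if_dvd_diff:
  assumes "var_q ^ m dvd P - Q" "n < m"
  shows "coeff3 P u v n = coeff3 Q u v n"
proof -
  obtain R where "P - Q = var_q ^ m * R" using assms(1) by auto
  then have "coeff (P - Q) n = 0"
    using assms(2) unfolding var_monom by (simp add: monom_power coeff_monom_mult)
  then show ?thesis by (simp add: coeff3_def)
qed

text \<open>The constant 3 is the largest minimal difference below an even part of colour
  \<open>Ca\<close>.\<close>

lemma in_below_large:
  assumes "y \<in> parts" "fst y + 3 \<le> 2 * j + 2"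
  shows "y \<in> below (2 * j + 2, Ca)"
  using assms
  by (elim parts_cases)
     (simp_all only: below_def part_simps cless_def mem_Collect_eq,
      simp_all add: row_def del: rank.simps)

text \<open>The head is at most the size \<open>n < j\<close>, so the restriction on it is
  vacuous.\<close>

lemma adm_below_large:
  assumes "n < j"
  shows "{p \<in> adm (below (2 * j + 2, Ca)). psize p = n \<and> weight_u p = u \<and> weight_v p = v} =
    {p. admissible p \<and> psize p = n \<and> weight_u p = u \<and> weight_v p = v}"
proof -
  have "hd p \<in> below (2 * j + 2, Ca)" if "admissible p" "psize p < j" "p \<noteq> []" for p
  proof (rule in_below_large)
    show "hd p \<in> parts" using that(1,3) by (cases p) (auto simp: admissible_Cons)
    show "fst (hd p) + 3 \<le> 2 * j + 2" using that(2,3) by (cases p) (auto simp: psize_def)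
  qed
  then show ?thesis using assms by (auto simp: adm_def)
qed

theorem theorem1p7:
  shows "\<forall>u v n. \<exists>N0. \<forall>N\<ge>N0. coeff3 (partial_prod N) u v n = int (D u v n)"
proof (intro allI exI impI)
  fix u v n N :: nat
  assume N: "Suc n \<le> N"
  \<comment> \<open>This choice gives both \<open>Suc n \<le> 2 * j\<close> for the congruence and
    \<open>n < j\<close> for \<open>adm_below_large\<close>.\<close>
  define j where "j = Suc n"
  define Q where "Q = below (2 * j + 2, Ca)"
  define T where "T = genfun (var_a * var_q ^ N) (var_b * var_q ^ N) var_q Q"
  have "var_q ^ Suc n dvd genfun var_a var_b var_q Q - partial_prod N * T"
    using dvd_S_shift_iterated[of var_q j var_a var_b N]
    unfolding Q_def T_def partial_prod_def
    by (rule dvd_trans[rotated]) (simp add: j_def le_imp_power_dvd)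
  moreover have "var_q ^ Suc n dvd partial_prod N * (T - 1)"
  proof (rule dvd_mult, rule dvd_trans)
    show "var_q ^ Suc n dvd var_q ^ N" using N by (rule le_imp_power_dvd)
    show "var_q ^ N dvd T - 1"
      unfolding T_def by (rule dvd_genfun_minus_1) (simp_all add: Q_def finite_below)
  qed
  ultimately have "var_q ^ Suc n dvd genfun var_a var_b var_q Q - partial_prod N"
    using dvd_add by (fastforce simp: algebra_simps)
  then have "coeff3 (partial_prod N) u v n = coeff3 (genfun var_a var_b var_q Q) u v n"
    by (rule coeff3_eq_if_dvd_diff[symmetric]) simp
  also have "\<dots> = int (D u v n)"
    unfolding D_def Q_def coeff3_genfun[OF finite_below]
    by (subst adm_below_large) (simp_all add: j_def)
  finally show "coeff3 (partial_prod N) u v n = int (D u v n)" .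
qed

end
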